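(* Let $0 \le a < b < \infty$, let $f : \mathbb{R} \times \mathbb{R} \to \mathbb{R}$ be continuous, and let $g(\tau) = \sum_{i=0}^n \alpha_i \tau^i$ (with $n \ge 0$, $\alpha_n \neq 0$) be a polynomial weight function on $[a,b]$. Consider the delay differential equation with distributed delay $$ \text{(D)} \qquad y'(t) = f\Big( y(t), \int_a^b y(t-\tau)\, g(\tau) \, \mathrm{d}\tau \Big) $$ and the system with discrete delays $$ \text{(E)} \qquad \begin{aligned} y'(t) &= f\Big( y(t), \sum_{i=0}^n \alpha_i x_i(t) \Big), \\ x_0'(t) &= y(t-a) - y(t-b), \\ x_i'(t) &= y(t-a)\, a^i - y(t-b)\, b^i + i\, x_{i-1}(t) \quad \text{for } i = 1, \ldots, n. \end{aligned} $$ Suppose that the solutions of initial value problems (of (D) and of (E)) exist and are unique for all $t \ge 0$. Let $y^* \in \mathbb{R}$ be a Lyapunov-stable stationary solution of (D), and put $$ x_i^* = y^* \, \frac{b^{i+1} - a^{i+1}}{i+1} \qquad \text{for } i = 0, 1, \ldots, n. $$ Then $(y^*, x_0^*, \ldots, x_n^* )^\top$ is a stationary solution of (E), and this stationary solution is unstable if $n \ge 2$.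
   Context: Weight function: $g : [a,b] \to \mathbb{R}$ has the properties of a probability density, i.e. it is measurable, $g(\tau) \ge 0$ for all $\tau \in [a,b]$, and $\int_a^b g(\tau)\,\mathrm{d}\tau = 1$. Initial value problem of (D): given a continuous history $\phi : [-b,0] \to \mathbb{R}$, a solution is a continuous $y : [-b,\infty) \to \mathbb{R}$, continuously differentiable on $(0,\infty)$ with $\lim_{t\to 0+} y'(t)$ existing, satisfying (D) for all $t>0$ and $y = \phi$ on $[-b,0]$. Initial value problem of (E): given a continuous history $\phi : [-b,0] \to \mathbb{R}$ and arbitrary real initial values $\xi_0, \ldots, \xi_n$ (not necessarily related to $\phi$), a solution consists of continuous $y : [-b,\infty) \to \mathbb{R}$ and $x_0,\ldots,x_n : [0,\infty) \to \mathbb{R}$, continuously differentiable on $(0,\infty)$ with right-sided limits of the derivatives existing at $0$, satisfying (E) for all $t>0$, $y = \phi$ on $[-b,0]$, and $x_i(0) = \xi_i$ for all $i$. Stationary solution: a solution that is constant in time. A constant $y^*$ is a stationary solution of (D) if and only if $f(y^*,y^* ) = 0$. Lyapunov stability for (D): $y^*$ is Lyapunov-stable if for every $\varepsilon > 0$ there is $\delta > 0$ such that $|\phi(t) - y^*| < \delta$ for all $t \in [-b,0]$ implies $|y(t) - y^*| < \varepsilon$ for all $t > 0$, for the solution $y$ with history $\phi$. Lyapunov stability for (E): $(y^*, x_0^*, \ldots, x_n^* )$ is Lyapunov-stable if for every $\varepsilon > 0$ there is $\delta > 0$ such that $|\phi(t) - y^*| < \delta$ for all $t \in [-b,0]$ and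 $|\xi_i - x_i^*| < \delta$ for all $i$ imply $|y(t) - y^*| < \varepsilon$ and $|x_i(t) - x_i^*| < \varepsilon$ for all $i$ and all $t > 0$. Unstable means not Lyapunov-stable. Convention: $\tau^0 = 1$ for all $\tau$, including $\tau = 0$. *)

theory Defs
  imports "HOL-Analysis.Analysis"
begin

text \<open>
  Functions on a subset of the reals are total functions of type \<open>real \<Rightarrow> real\<close> whose values
  outside the intended domain are irrelevant: histories live on \<open>{-b..0}\<close>, the component \<open>y\<close> of a
  solution on \<open>{-b..}\<close>, the auxiliary components \<open>x i\<close> (for \<open>i \<le> n\<close>) on \<open>{0..}\<close>, weights
  on \<open>{a..b}\<close>.
\<close>

definition weight_function :: "real \<Rightarrow> real \<Rightarrow> (real \<Rightarrow> real) \<Rightarrow> bool" where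
  "weight_function a b g \<longleftrightarrow>
     g \<in> borel_measurable (lebesgue_on {a..b}) \<and>
     (\<forall>\<tau>\<in>{a..b}. 0 \<le> g \<tau>) \<and>
     (g has_integral 1) {a..b}"

definition C1_pos :: "(real \<Rightarrow> real) \<Rightarrow> bool" where
  "C1_pos u \<longleftrightarrow>
     (\<forall>t>0. u differentiable (at t)) \<and>
     continuous_on {0<..} (deriv u) \<and>
     (\<exists>L. (deriv u \<longlongrightarrow> L) (at_right 0))"


subsection \<open>The equation with distributed delay\<close>

definition solution_D ::
  "real \<Rightarrow> real \<Rightarrow> (real \<times> real \<Rightarrow> real) \<Rightarrow> (real \<Rightarrow> real) \<Rightarrow> (real \<Rightarrow> real) \<Rightarrow> (real \<Rightarrow> real) \<Rightarrow> bool"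
where
  "solution_D a b f g \<phi> y \<longleftrightarrow>
     continuous_on {-b..} y \<and> C1_pos y \<and>
     (\<forall>t>0. (y has_real_derivative
               f (y t, integral {a..b} (\<lambda>\<tau>. y (t - \<tau>) * g \<tau>))) (at t)) \<and>
     (\<forall>t\<in>{-b..0}. y t = \<phi> t)"

definition uniquely_solvable_D ::
  "real \<Rightarrow> real \<Rightarrow> (real \<times> real \<Rightarrow> real) \<Rightarrow> (real \<Rightarrow> real) \<Rightarrow> bool"
where
  "uniquely_solvable_D a b f g \<longleftrightarrow>
     (\<forall>\<phi>. continuous_on {-b..0} \<phi> \<longrightarrow>
        (\<exists>y. solution_D a b f g \<phi> y) \<and>
        (\<forall>y z. solution_D a b f g \<phi> y \<and> solution_D a b f g \<phi> z \<longrightarrow> (\<forall>t\<ge>-b. y t = z t)))"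

definition stationary_D ::
  "real \<Rightarrow> real \<Rightarrow> (real \<times> real \<Rightarrow> real) \<Rightarrow> (real \<Rightarrow> real) \<Rightarrow> real \<Rightarrow> bool"
where
  "stationary_D a b f g ys \<longleftrightarrow> solution_D a b f g (\<lambda>_. ys) (\<lambda>_. ys)"

definition Lyapunov_stable_D ::
  "real \<Rightarrow> real \<Rightarrow> (real \<times> real \<Rightarrow> real) \<Rightarrow> (real \<Rightarrow> real) \<Rightarrow> real \<Rightarrow> bool"
where
  "Lyapunov_stable_D a b f g ys \<longleftrightarrow>
     (\<forall>\<epsilon>>0. \<exists>\<delta>>0. \<forall>\<phi> y.
        continuous_on {-b..0} \<phi> \<and> solution_D a b f g \<phi> y \<and>
        (\<forall>t\<in>{-b..0}. \<bar>\<phi> t - ys\<bar> < \<delta>) \<longrightarrow>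
        (\<forall>t>0. \<bar>y t - ys\<bar> < \<epsilon>))"


subsection \<open>The system with discrete delays\<close>

definition solution_E ::
  "real \<Rightarrow> real \<Rightarrow> (real \<times> real \<Rightarrow> real) \<Rightarrow> nat \<Rightarrow> (nat \<Rightarrow> real) \<Rightarrow>
   (real \<Rightarrow> real) \<Rightarrow> (nat \<Rightarrow> real) \<Rightarrow> (real \<Rightarrow> real) \<Rightarrow> (nat \<Rightarrow> real \<Rightarrow> real) \<Rightarrow> bool"
where
  "solution_E a b f n \<alpha> \<phi> \<xi> y x \<longleftrightarrow>
     continuous_on {-b..} y \<and> C1_pos y \<and>
     (\<forall>i\<le>n. continuous_on {0..} (x i) \<and> C1_pos (x i)) \<and>
     (\<forall>t>0.
        (y has_real_derivative f (y t, \<Sum>i\<le>n. \<alpha> i * x i t)) (at t) \<and>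
        (x 0 has_real_derivative y (t - a) - y (t - b)) (at t) \<and>
        (\<forall>i\<in>{1..n}. (x i has_real_derivative
             y (t - a) * a ^ i - y (t - b) * b ^ i + real i * x (i - 1) t) (at t))) \<and>
     (\<forall>t\<in>{-b..0}. y t = \<phi> t) \<and>
     (\<forall>i\<le>n. x i 0 = \<xi> i)"

definition uniquely_solvable_E ::
  "real \<Rightarrow> real \<Rightarrow> (real \<times> real \<Rightarrow> real) \<Rightarrow> nat \<Rightarrow> (nat \<Rightarrow> real) \<Rightarrow> bool"
where
  "uniquely_solvable_E a b f n \<alpha> \<longleftrightarrow>
     (\<forall>\<phi> \<xi>. continuous_on {-b..0} \<phi> \<longrightarrow>
        (\<exists>y x. solution_E a b f n \<alpha> \<phi> \<xi> y x) \<and>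
        (\<forall>y x z w. solution_E a b f n \<alpha> \<phi> \<xi> y x \<and> solution_E a b f n \<alpha> \<phi> \<xi> z w \<longrightarrow>
           (\<forall>t\<ge>-b. y t = z t) \<and> (\<forall>i\<le>n. \<forall>t\<ge>0. x i t = w i t)))"

definition stationary_E ::
  "real \<Rightarrow> real \<Rightarrow> (real \<times> real \<Rightarrow> real) \<Rightarrow> nat \<Rightarrow> (nat \<Rightarrow> real) \<Rightarrow> real \<Rightarrow> (nat \<Rightarrow> real) \<Rightarrow> bool"
where
  "stationary_E a b f n \<alpha> ys xs \<longleftrightarrow>
     solution_E a b f n \<alpha> (\<lambda>_. ys) xs (\<lambda>_. ys) (\<lambda>i _. xs i)"

definition Lyapunov_stable_E ::
  "real \<Rightarrow> real \<Rightarrow> (real \<times> real \<Rightarrow> real) \<Rightarrow> nat \<Rightarrow> (nat \<Rightarrow> real) \<Rightarrow> real \<Rightarrow> (nat \<Rightarrow> real) \<Rightarrow> bool"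
where
  "Lyapunov_stable_E a b f n \<alpha> ys xs \<longleftrightarrow>
     (\<forall>\<epsilon>>0. \<exists>\<delta>>0. \<forall>\<phi> \<xi> y x.
        continuous_on {-b..0} \<phi> \<and> solution_E a b f n \<alpha> \<phi> \<xi> y x \<and>
        (\<forall>t\<in>{-b..0}. \<bar>\<phi> t - ys\<bar> < \<delta>) \<and> (\<forall>i\<le>n. \<bar>\<xi> i - xs i\<bar> < \<delta>) \<longrightarrow>
        (\<forall>t>0. \<bar>y t - ys\<bar> < \<epsilon> \<and> (\<forall>i\<le>n. \<bar>x i t - xs i\<bar> < \<epsilon>)))"

definition unstable_E ::
  "real \<Rightarrow> real \<Rightarrow> (real \<times> real \<Rightarrow> real) \<Rightarrow> nat \<Rightarrow> (nat \<Rightarrow> real) \<Rightarrow> real \<Rightarrow> (nat \<Rightarrow> real) \<Rightarrow> bool"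
where
  "unstable_E a b f n \<alpha> ys xs \<longleftrightarrow> \<not> Lyapunov_stable_E a b f n \<alpha> ys xs"

end

theory Submission
  imports Defs
begin

text \<open>
  The moments \<open>m\<^sub>i(t) = \<integral>\<^sub>a\<^sup>b y(t - \<tau>) \<tau>\<^sup>i d\<tau>\<close> satisfy the same equations as the \<open>x\<^sub>i\<close>, so the
  differences \<open>c\<^sub>i = x\<^sub>i - m\<^sub>i\<close> obey \<open>c\<^sub>0' = 0\<close> and \<open>c\<^sub>1' = c\<^sub>0\<close>. Perturbing \<open>\<xi>\<^sub>0\<close> alone makes \<open>c\<^sub>0\<close> a
  nonzero constant, hence \<open>c\<^sub>1\<close> unbounded; but \<open>m\<^sub>1\<close> is bounded as long as \<open>y\<close> is, so \<open>x\<^sub>1\<close> and \<open>y\<close>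
  cannot both stay near the stationary solution.
\<close>

text \<open>Global antiderivatives allow the moments to be differentiated by the chain rule instead
  of under the integral sign.\<close>

lemma continuous_real_antiderivative:
  fixes z :: "real \<Rightarrow> real"
  assumes "continuous_on UNIV z"
  obtains Z where "\<And>s. (Z has_real_derivative z s) (at s)"
proof -
  have "\<exists>Z. \<forall>s::real. -\<infinity> < ereal s \<longrightarrow> ereal s < \<infinity> \<longrightarrow> (Z has_vector_derivative z s) (at s)"
    by (rule einterval_antiderivative) (use assms in \<open>auto simp: continuous_on_eq_continuous_at\<close>)
  then show thesis
    using that by (auto simp: has_real_derivative_iff_has_vector_derivative)
qed

text \<open>
  For \<open>Y' = z\<close> and \<open>Z' = Y\<close>, integration by parts turns the first moment
  \<open>\<integral>\<^sub>a\<^sup>b z(t - \<tau>) \<tau> d\<tau>\<close> into the expression bounded here.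
\<close>
lemma first_moment_bound:
  fixes z Y Z :: "real \<Rightarrow> real"
  assumes "0 \<le> a" "a < b"
    and Y: "\<And>s. (Y has_real_derivative z s) (at s)"
    and Z: "\<And>s. (Z has_real_derivative Y s) (at s)"
    and bound: "\<And>s. s \<ge> t - b \<Longrightarrow> \<bar>z s\<bar> \<le> M"
  shows "\<bar>a * Y (t - a) - b * Y (t - b) + (Z (t - a) - Z (t - b))\<bar> \<le> (b - a) * (b * M)"
proof -
  define G where "G = (\<lambda>\<tau>. - (\<tau> * Y (t - \<tau>)) - Z (t - \<tau>))"
  have G: "(G has_real_derivative \<tau> * z (t - \<tau>)) (at \<tau>)" for \<tau>
    unfolding G_def
    by (auto intro!: derivative_eq_intros DERIV_chain2[OF Y] DERIV_chain2[OF Z])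
  \<comment> \<open>The mean value theorem turns the integral over \<open>{a..b}\<close> into
    \<open>b - a\<close> times one value of the integrand.\<close>
  obtain \<tau> where \<tau>: "a < \<tau>" "\<tau> < b" and eq: "G b - G a = (b - a) * (\<tau> * z (t - \<tau>))"
    using MVT2[OF \<open>a < b\<close>, of G "\<lambda>\<tau>. \<tau> * z (t - \<tau>)"] G by metis
  have "\<bar>\<tau> * z (t - \<tau>)\<bar> \<le> b * M"
    unfolding abs_mult using \<tau> assms(1) bound[of "t - \<tau>"] by (intro mult_mono) auto
  then have "\<bar>G b - G a\<bar> \<le> (b - a) * (b * M)"
    unfolding eq abs_mult[of "b - a"] using \<open>a < b\<close> by (intro mult_mono) auto
  then show ?thesis
    unfolding G_def by (simp add: algebra_simps)
qed

text \<open>A weight of mass 1 averages the constant \<open>ys\<close> to itself, while the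
  derivative of a constant vanishes; time 1 stands for any positive time.\<close>

lemma stationary_D_zero:
  assumes "weight_function a b g" "stationary_D a b f g ys"
  shows "f (ys, ys) = 0"
proof -
  have "((\<lambda>\<tau>. ys * g \<tau>) has_integral ys * 1) {a..b}"
    using assms(1) unfolding weight_function_def by (intro has_integral_mult_right) auto
  then have int: "integral {a..b} (\<lambda>\<tau>. ys * g \<tau>) = ys"
    unfolding mult_1_right by (rule integral_unique)
  have "((\<lambda>_. ys) has_real_derivative f (ys, integral {a..b} (\<lambda>\<tau>. ys * g \<tau>))) (at 1)"
    using assms(2) unfolding stationary_D_def solution_D_def by simp
  then show ?thesis
    unfolding int using DERIV_const DERIV_unique by blast
qed

text \<open>This is the normalization of \<open>g\<close>, integrated monomial by monomial. It makes
  the sum of \<open>\<alpha> i * xs i\<close> collapse to \<open>ys\<close>.\<close>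

lemma polynomial_weight_moments:
  assumes "a < b" "weight_function a b g"
    and "\<And>\<tau>. \<tau> \<in> {a..b} \<Longrightarrow> g \<tau> = (\<Sum>i\<le>n. \<alpha> i * \<tau> ^ i)"
  shows "(\<Sum>i\<le>n. \<alpha> i * ((b ^ (i + 1) - a ^ (i + 1)) / real (i + 1))) = 1"
proof -
  have pow: "((\<lambda>\<tau>. \<tau> ^ i) has_integral (b ^ (i + 1) - a ^ (i + 1)) / real (i + 1)) {a..b}" for i
  proof -
    have "((\<lambda>\<tau>. \<tau> ^ i) has_integral
        b ^ (i + 1) / real (i + 1) - a ^ (i + 1) / real (i + 1)) {a..b}"
    proof (rule fundamental_theorem_of_calculus)
      show "((\<lambda>\<tau>. \<tau> ^ (i + 1) / real (i + 1)) has_vector_derivative \<tau> ^ i)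
          (at \<tau> within {a..b})" for \<tau>
        using DERIV_cdivide[OF DERIV_pow[of "i + 1" \<tau> "{a..b}"], of "real (i + 1)"]
        by (simp add: has_real_derivative_iff_has_vector_derivative del: of_nat_Suc power_Suc)
    qed (use \<open>a < b\<close> in auto)
    then show ?thesis by (simp add: diff_divide_distrib)
  qed
  have "((\<lambda>\<tau>. \<Sum>i\<le>n. \<alpha> i * \<tau> ^ i) has_integral
      (\<Sum>i\<le>n. \<alpha> i * ((b ^ (i + 1) - a ^ (i + 1)) / real (i + 1)))) {a..b}"
    by (intro has_integral_sum has_integral_mult_right pow) auto
  then have "(g has_integral
      (\<Sum>i\<le>n. \<alpha> i * ((b ^ (i + 1) - a ^ (i + 1)) / real (i + 1)))) {a..b}"
    by (rule has_integral_eq[rotated]) (simp add: assms(3))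
  then show ?thesis
    using assms(2) unfolding weight_function_def by (blast intro: has_integral_unique)
qed

lemma C1_pos_const: "C1_pos (\<lambda>_. c)"
  unfolding C1_pos_def by auto

lemma stationary_E_moments:
  assumes "f (ys, ys) = 0"
    and sum: "(\<Sum>i\<le>n. \<alpha> i * ((b ^ (i + 1) - a ^ (i + 1)) / real (i + 1))) = 1"
    and xs: "\<And>i. i \<le> n \<Longrightarrow> xs i = ys * ((b ^ (i + 1) - a ^ (i + 1)) / real (i + 1))"
  shows "stationary_E a b f n \<alpha> ys xs"
proof -
  have "(\<Sum>i\<le>n. \<alpha> i * xs i)
      = ys * (\<Sum>i\<le>n. \<alpha> i * ((b ^ (i + 1) - a ^ (i + 1)) / real (i + 1)))"
    unfolding sum_distrib_left by (intro sum.cong) (auto simp: xs)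
  then have y: "f (ys, \<Sum>i\<le>n. \<alpha> i * xs i) = 0"
    using sum assms(1) by simp
  \<comment> \<open>For \<open>i \<ge> 1\<close> the index shift cancels the denominator:
    \<open>xs (i - 1)\<close> has denominator \<open>i\<close>.\<close>
  have x: "ys * a ^ i - ys * b ^ i + real i * xs (i - 1) = 0" if "i \<in> {1..n}" for i
  proof -
    have "real i * xs (i - 1) = ys * (b ^ i - a ^ i)"
      using that xs[of "i - 1"] by (auto simp: field_simps)
    then show ?thesis
      by (simp add: algebra_simps)
  qed
  show ?thesis
    unfolding stationary_E_def solution_E_def
    by (simp add: C1_pos_const x y del: One_nat_def)
qed

text \<open>The history stays exactly at \<open>ys\<close> and the perturbation sits in
  \<open>\<xi> 0\<close>; the component that escapes is \<open>x 1\<close>, hence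
  \<open>n \<ge> 1\<close>.\<close>

lemma unstable_E_if_perturbed_solutions_exist:
  assumes "0 \<le> a" "a < b" "n \<ge> 1"
    and exist: "\<And>\<xi>. \<exists>y x. solution_E a b f n \<alpha> (\<lambda>_. ys) \<xi> y x"
    and xs0: "xs 0 = ys * (b - a)"
  shows "unstable_E a b f n \<alpha> ys xs"
  unfolding unstable_E_def
proof
  assume stable: "Lyapunov_stable_E a b f n \<alpha> ys xs"
  obtain \<delta> where "\<delta> > 0" and \<delta>: "\<And>\<phi> \<xi> y x.
      continuous_on {-b..0} \<phi> \<and> solution_E a b f n \<alpha> \<phi> \<xi> y x \<and>
      (\<forall>t\<in>{-b..0}. \<bar>\<phi> t - ys\<bar> < \<delta>) \<and> (\<forall>i\<le>n. \<bar>\<xi> i - xs i\<bar> < \<delta>) \<Longrightarrow>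
      \<forall>t>0. \<bar>y t - ys\<bar> < 1 \<and> (\<forall>i\<le>n. \<bar>x i t - xs i\<bar> < 1)"
    using stable unfolding Lyapunov_stable_E_def by (metis zero_less_one)
  define \<xi> where "\<xi> = xs(0 := xs 0 + \<delta> / 2)"
  obtain y x where sol: "solution_E a b f n \<alpha> (\<lambda>_. ys) \<xi> y x"
    using exist by blast
  have near: "\<bar>y t - ys\<bar> < 1 \<and> (\<forall>i\<le>n. \<bar>x i t - xs i\<bar> < 1)" if "t > 0" for t
  proof -
    have "\<forall>i\<le>n. \<bar>\<xi> i - xs i\<bar> < \<delta>"
      using \<open>\<delta> > 0\<close> by (auto simp: \<xi>_def)
    then show ?thesis
      using \<delta>[of "\<lambda>_. ys" \<xi> y x] sol \<open>\<delta> > 0\<close> that by auto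
  qed
  have hist: "y t = ys" if "t \<in> {-b..0}" for t
    using sol that unfolding solution_E_def by blast
  have cont_x: "continuous_on {0..} (x 0)" "continuous_on {0..} (x 1)"
    and init: "x 0 0 = xs 0 + \<delta> / 2" "x 1 0 = xs 1"
    using sol \<open>n \<ge> 1\<close> unfolding solution_E_def \<xi>_def by auto
  have deriv_x0: "(x 0 has_real_derivative y (t - a) - y (t - b)) (at t)"
    and deriv_x1: "(x 1 has_real_derivative y (t - a) * a - y (t - b) * b + x 0 t) (at t)"
    if "t > 0" for t
    using sol that \<open>n \<ge> 1\<close> unfolding solution_E_def by force+

  \<comment> \<open>Extending \<open>y\<close> to the left of \<open>-b\<close> by its value there
    keeps it continuous and bounded, and gives it antiderivatives on the whole line.\<close>
  define z where "z = (\<lambda>s. y (max s (- b)))"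
  have cont_y: "continuous_on {-b..} y"
    using sol unfolding solution_E_def by blast
  have cont_z: "continuous_on UNIV z"
    unfolding z_def
    by (rule continuous_on_compose2[OF cont_y]) (auto intro!: continuous_intros)
  have z_y: "z s = y s" if "s \<ge> -b" for s
    using that by (simp add: z_def max_def)
  define M where "M = \<bar>ys\<bar> + 1"
  have M: "\<bar>z s\<bar> \<le> M" for s
    using near[of s] hist[of s] hist[of "-b"] assms(1,2) unfolding z_def M_def
    by (cases "s \<le> -b"; cases "s \<le> 0") (auto simp: max_def)
  obtain Y where Y: "\<And>s. (Y has_real_derivative z s) (at s)"
    using continuous_real_antiderivative[OF cont_z] by blast
  have "continuous_on UNIV Y"
    by (meson DERIV_continuous Y continuous_at_imp_continuous_on)
  then obtain Z where Z: "\<And>s. (Z has_real_derivative Y s) (at s)"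
    using continuous_real_antiderivative by blast

  \<comment> \<open>These are the moments of orders 0 and 1 of \<open>z (t - \<tau>)\<close> over
    \<open>{a..b}\<close>, written through \<open>Y\<close> and \<open>Z\<close>; the second form
    comes from integration by parts.\<close>
  define m0 where "m0 = (\<lambda>t. Y (t - a) - Y (t - b))"
  define m1 where "m1 = (\<lambda>t. a * Y (t - a) - b * Y (t - b) + (Z (t - a) - Z (t - b)))"
  have deriv_m0: "(m0 has_real_derivative z (t - a) - z (t - b)) (at t)" for t
    unfolding m0_def
    by (auto intro!: derivative_eq_intros DERIV_chain2[OF Y])
  have deriv_m1: "(m1 has_real_derivative z (t - a) * a - z (t - b) * b + m0 t) (at t)" for t
    unfolding m1_def m0_def
    by (auto intro!: derivative_eq_intros DERIV_chain2[OF Y] DERIV_chain2[OF Z])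
  have cont_m: "continuous_on S m0" "continuous_on S m1" for S
    by (meson DERIV_continuous deriv_m0 deriv_m1 continuous_at_imp_continuous_on)+
  have m1_bound: "\<bar>m1 t\<bar> \<le> (b - a) * (b * M)" for t
    unfolding m1_def by (rule first_moment_bound[OF assms(1,2) Y Z M])

  have "m0 0 = xs 0"
  proof -
    \<comment> \<open>Since \<open>0 \<le> a\<close>, the interval from \<open>-b\<close> to
      \<open>-a\<close> lies in the history, where \<open>y\<close> is \<open>ys\<close>.\<close>
    have "Y (- a) - ys * (- a) = Y (- b) - ys * (- b)"
    proof (rule DERIV_isconst_end[of "-b" "-a" "\<lambda>s. Y s - ys * s"])
      show "continuous_on {-b..-a} (\<lambda>s. Y s - ys * s)"
        by (intro continuous_intros continuous_on_subset[OF \<open>continuous_on UNIV Y\<close>]) auto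
      show "((\<lambda>s. Y s - ys * s) has_real_derivative 0) (at s)" if "-b < s" "s < -a" for s
        using that assms(1) z_y[of s] hist[of s]
        by (auto intro!: derivative_eq_intros Y)
    qed (use \<open>a < b\<close> in auto)
    then show ?thesis
      by (simp add: m0_def xs0 algebra_simps)
  qed
  have c0: "x 0 t - m0 t = \<delta> / 2" if "t > 0" for t
  proof -
    \<comment> \<open>The equations hold only for positive times, so continuity at 0 carries the
      constant back to the initial value.\<close>
    have "x 0 t - m0 t = x 0 0 - m0 0"
    proof (rule DERIV_isconst_end[OF that, of "\<lambda>t. x 0 t - m0 t"])
      show "continuous_on {0..t} (\<lambda>t. x 0 t - m0 t)"
        by (intro continuous_intros cont_m continuous_on_subset[OF cont_x(1)]) auto
      show "((\<lambda>t. x 0 t - m0 t) has_real_derivative 0) (at s)" if "0 < s" for s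
        using DERIV_diff[OF deriv_x0[OF that] deriv_m0[of s]] that assms(1,2)
        by (simp add: z_y)
    qed
    then show ?thesis
      using init \<open>m0 0 = xs 0\<close> by simp
  qed
  \<comment> \<open>The difference \<open>x 1 - m1\<close> has slope \<open>\<delta> / 2\<close> by
    \<open>c0\<close>, so removing this linear drift leaves a constant.\<close>
  have c1: "x 1 t - m1 t - \<delta> / 2 * t = xs 1 - m1 0" if "t > 0" for t
  proof -
    have "x 1 t - m1 t - \<delta> / 2 * t = x 1 0 - m1 0 - \<delta> / 2 * 0"
    proof (rule DERIV_isconst_end[OF that, of "\<lambda>t. x 1 t - m1 t - \<delta> / 2 * t"])
      show "continuous_on {0..t} (\<lambda>t. x 1 t - m1 t - \<delta> / 2 * t)"
        by (intro continuous_intros cont_m continuous_on_subset[OF cont_x(2)]) auto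
      show "((\<lambda>t. x 1 t - m1 t - \<delta> / 2 * t) has_real_derivative 0) (at s)" if "0 < s" for s
        using DERIV_diff[OF DERIV_diff[OF deriv_x1[OF that] deriv_m1[of s]]
            DERIV_cmult_Id[of "\<delta> / 2" s UNIV]] that assms(1,2) c0[OF that]
        by (simp add: z_y)
    qed
    then show ?thesis
      using init by simp
  qed

  \<comment> \<open>At the time when the drift reaches \<open>B\<close>, the values
    \<open>m1 t\<close> and \<open>m1 0\<close> can offset at most \<open>B - 1\<close> of it, so
    \<open>x 1\<close> is at distance at least 1 from \<open>xs 1\<close>.\<close>
  define B where "B = 1 + 2 * ((b - a) * (b * M))"
  have "B > 0"
    using assms(1,2) m1_bound[of 0] unfolding B_def by linarith
  define t where "t = 2 * B / \<delta>"
  have t: "t > 0" "\<delta> / 2 * t = B"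
    using \<open>B > 0\<close> \<open>\<delta> > 0\<close> by (auto simp: t_def)
  have "\<bar>x 1 t - xs 1\<bar> < 1"
    using near[OF t(1)] \<open>n \<ge> 1\<close> by blast
  then show False
    using c1[OF t(1)] t(2) m1_bound[of t] m1_bound[of 0] unfolding B_def by linarith
qed

theorem theorem3:
  fixes a b :: real and f :: "real \<times> real \<Rightarrow> real" and g :: "real \<Rightarrow> real"
    and n :: nat and \<alpha> :: "nat \<Rightarrow> real" and ys :: real and xs :: "nat \<Rightarrow> real"
  assumes "0 \<le> a" and "a < b"
    and "continuous_on UNIV f"
    and "weight_function a b g"
    and "\<And>\<tau>. \<tau> \<in> {a..b} \<Longrightarrow> g \<tau> = (\<Sum>i\<le>n. \<alpha> i * \<tau> ^ i)"
    and "\<alpha> n \<noteq> 0"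
    and "uniquely_solvable_D a b f g"
    and "uniquely_solvable_E a b f n \<alpha>"
    and "stationary_D a b f g ys"
    and "Lyapunov_stable_D a b f g ys"
    and "\<And>i. i \<le> n \<Longrightarrow> xs i = ys * ((b ^ (i + 1) - a ^ (i + 1)) / real (i + 1))"
  shows "stationary_E a b f n \<alpha> ys xs \<and> (n \<ge> 2 \<longrightarrow> unstable_E a b f n \<alpha> ys xs)"
proof (intro conjI impI)
  show "stationary_E a b f n \<alpha> ys xs"
    using stationary_D_zero[OF assms(4,9)] polynomial_weight_moments[OF assms(2,4,5)] assms(11)
    by (rule stationary_E_moments)
  assume "n \<ge> 2"
  show "unstable_E a b f n \<alpha> ys xs"
  proof (rule unstable_E_if_perturbed_solutions_exist[OF assms(1,2)])
    show "\<exists>y x. solution_E a b f n \<alpha> (\<lambda>_. ys) \<xi> y x" for \<xi>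
      using assms(8) unfolding uniquely_solvable_E_def by simp
  qed (use \<open>n \<ge> 2\<close> assms(11)[of 0] in auto)
qed

end
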